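(* Let $N\ge2$ and let $(S_i)_{i\in\mathbb{Z}_N}$ be an atomic representation of $\mathcal{O}_N$ on a separable Hilbert space $\mathcal{H}$. Then the representation is monic if and only if, for every atom $\omega\in\mathcal{K}_N$, $P(\omega)\mathcal{H}$ is one-dimensional. In this case, the measure $\mu$ from a monic system $(\mu,(f_i)_{i\in\mathbb{Z}_N})$ whose associated representation is unitarily equivalent to $(S_i)_{i\in\mathbb{Z}_N}$ is atomic, and the set of atoms is countable.
   Context: Let $\mathbb{Z}_N=\{0,1,\dots,N-1\}$. A representation of $\mathcal{O}_N$ on a Hilbert space $\mathcal{H}$ is a family of isometries $(S_i)_{i\in\mathbb{Z}_N}$ with $S_i^*S_j=\delta_{ij}I$ and $\sum_{i}S_iS_i^*=I$. For a finite word $I=i_1\dots i_n$, $S_I:=S_{i_1}\cdots S_{i_n}$. The representation is monic if there is $\varphi\in\mathcal{H}$ such that the closed linear span of $\{S_IS_I^*\varphi : I \text{ a finite word}\}$ is $\mathcal{H}$. Let $\mathcal{K}_N=\prod_1^\infty\mathbb{Z}_N$ be the compact space of infinite words (product topology), $\sigma(\omega_1\omega_2\dots)=\omega_2\omega_3\dots$, $\sigma_i(\omega_1\omega_2\dots)=i\omega_1\omega_2\dots$, and $\mathcal{C}(I)=\{\omega:\omega_1=i_1,\dots,\omega_n=i_n\}$. The projection valued measure associated to the representation is the unique projection valued measure $P$ on the Borel $\sigma$-algebra of $\mathcal{K}_N$ with $P(\mathcal{C}(I))=S_IS_I^*$ for every finite word $I$; write $P(\omega)=P(\{\omega\})$ for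 $\omega\in\mathcal{K}_N$. The representation is atomic if there is a subset $\Omega\subset\mathcal{K}_N$ with $\sum_{\omega\in\Omega}P(\omega)=I$ (the identity). A point $\omega\in\mathcal{K}_N$ with $P(\omega)\ne0$ is called an atom. A monic system is a pair $(\mu,(f_i)_{i\in\mathbb{Z}_N})$ where $\mu$ is a finite Borel measure on $\mathcal{K}_N$ with push-forwards $\mu\circ\sigma_i^{-1}\ll\mu$ for all $i$, and $f_i\in L^2(\mu)$ (complex-valued) are functions such that $\frac{d(\mu\circ\sigma_i^{-1})}{d\mu}=|f_i|^2$ and $f_i(x)\ne0$ for $\mu$-a.e. $x\in\sigma_i(\mathcal{K}_N)$. The associated representation of $\mathcal{O}_N$ is the one on $L^2(\mu)$ given by $S_if=f_i\,(f\circ\sigma)$. (Every monic representation is unitarily equivalent to one associated to a monic system.) *)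

theory Defs
  imports "HOL-Analysis.Analysis"
begin

section \<open>Complex Hilbert spaces\<close>

text \<open>The inner product is linear in the first and conjugate linear in the second argument.
  The last axiom says that the norm of the Banach space is the one induced by the inner product;
  in particular the inner product is positive definite.\<close>

class complex_hilbert = banach +
  fixes scaleC :: "complex \<Rightarrow> 'a \<Rightarrow> 'a" (infixr "*\<^sub>C" 75)
    and cinner :: "'a \<Rightarrow> 'a \<Rightarrow> complex"
  assumes scaleC_add_right: "c *\<^sub>C (x + y) = c *\<^sub>C x + c *\<^sub>C y"
    and scaleC_add_left: "(c + d) *\<^sub>C x = c *\<^sub>C x + d *\<^sub>C x"
    and scaleC_scaleC: "c *\<^sub>C d *\<^sub>C x = (c * d) *\<^sub>C x"
    and scaleC_one: "1 *\<^sub>C x = x"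
    and scaleR_scaleC: "r *\<^sub>R x = complex_of_real r *\<^sub>C x"
    and cinner_commute: "cinner x y = cnj (cinner y x)"
    and cinner_add_left: "cinner (x + y) z = cinner x z + cinner y z"
    and cinner_scaleC_left: "cinner (c *\<^sub>C x) y = c * cinner x y"
    and cinner_self: "cinner x x = complex_of_real ((norm x)\<^sup>2)"

instantiation complex :: complex_hilbert
begin

definition scaleC_complex :: "complex \<Rightarrow> complex \<Rightarrow> complex"
  where "scaleC_complex c x = c * x"

definition cinner_complex :: "complex \<Rightarrow> complex \<Rightarrow> complex"
  where "cinner_complex x y = x * cnj y"

instance
  by standard
    (auto simp: scaleC_complex_def cinner_complex_def algebra_simps scaleR_conv_of_real
      complex_norm_square[symmetric] simp del: of_real_power)

end

global_interpretation complex_vector: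
  vector_space "scaleC :: complex \<Rightarrow> 'a \<Rightarrow> 'a::complex_hilbert"
  defines cspan = complex_vector.span
    and cdim = complex_vector.dim
  by unfold_locales (simp_all add: scaleC_add_right scaleC_add_left scaleC_scaleC scaleC_one)

definition bounded_clinear :: "('a::complex_hilbert \<Rightarrow> 'b::complex_hilbert) \<Rightarrow> bool"
  where "bounded_clinear T \<longleftrightarrow> bounded_linear T \<and> (\<forall>c x. T (c *\<^sub>C x) = c *\<^sub>C T x)"

definition cadjoint :: "('a::complex_hilbert \<Rightarrow> 'b::complex_hilbert) \<Rightarrow> 'b \<Rightarrow> 'a"
  where "cadjoint T = (SOME T'. \<forall>x y. cinner (T x) y = cinner x (T' y))"

lemma cadjoint_unique:
  assumes T': "\<And>x y. cinner (T x) y = cinner x (T' y)"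
  shows "cadjoint T = T'"
proof -
  have eq: "T1 y = T2 y"
    if 1: "\<forall>x y. cinner (T x) y = cinner x (T1 y)"
      and 2: "\<forall>x y. cinner (T x) y = cinner x (T2 y)" for T1 T2 y
  proof -
    let ?d = "T1 y - T2 y"
    have "cinner ?d (T1 y) = cinner ?d (T2 y)"
      using 1 2 by metis
    then have "cinner (T1 y) ?d = cinner (T2 y) ?d"
      by (metis cinner_commute)
    then have "cinner ?d ?d = 0"
      using cinner_add_left[of ?d "T2 y" ?d] by simp
    then show ?thesis
      by (simp add: cinner_self)
  qed
  have "\<forall>x y. cinner (T x) y = cinner x (cadjoint T y)"
    unfolding cadjoint_def by (rule someI[where x = T']) (simp add: T')
  with T' show ?thesis
    by (intro ext eq) auto
qed

definition orthogonal_projection :: "('a::complex_hilbert \<Rightarrow> 'a) \<Rightarrow> bool"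
  where "orthogonal_projection T \<longleftrightarrow>
    bounded_clinear T \<and> (\<forall>x. T (T x) = T x) \<and> (\<forall>x y. cinner (T x) y = cinner x (T y))"


section \<open>Infinite words\<close>

text \<open>An infinite word is a function on \<open>nat\<close>, so its \<open>k\<close>-th letter (counting from 1) is the
  value at \<open>k - 1\<close>. A finite word is a list, possibly empty.\<close>

definition word_topology :: "nat \<Rightarrow> (nat \<Rightarrow> nat) topology"
  where "word_topology N = product_topology (\<lambda>_. discrete_topology {..<N}) UNIV"

definition words :: "nat \<Rightarrow> (nat \<Rightarrow> nat) set"
  where "words N = {\<omega>. \<forall>k. \<omega> k < N}"

lemma topspace_word_topology: "topspace (word_topology N) = words N"
  by (auto simp: word_topology_def words_def PiE_def)

definition word_borel :: "nat \<Rightarrow> (nat \<Rightarrow> nat) measure"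
  where "word_borel N = sigma (words N) {U. openin (word_topology N) U}"

definition shift :: "(nat \<Rightarrow> nat) \<Rightarrow> nat \<Rightarrow> nat"
  where "shift \<omega> = (\<lambda>k. \<omega> (Suc k))"

definition prepend :: "nat \<Rightarrow> (nat \<Rightarrow> nat) \<Rightarrow> nat \<Rightarrow> nat"
  where "prepend i \<omega> = (\<lambda>k. case k of 0 \<Rightarrow> i | Suc m \<Rightarrow> \<omega> m)"

definition finite_words :: "nat \<Rightarrow> nat list set"
  where "finite_words N = lists {..<N}"

definition cylinder :: "nat \<Rightarrow> nat list \<Rightarrow> (nat \<Rightarrow> nat) set"
  where "cylinder N I = {\<omega> \<in> words N. \<forall>k<length I. \<omega> k = I ! k}"


section \<open>Representations of the Cuntz algebra\<close>

text \<open>Only the values \<open>S i\<close> for \<open>i < N\<close> matter.\<close>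

definition cuntz_rep :: "nat \<Rightarrow> (nat \<Rightarrow> 'h::complex_hilbert \<Rightarrow> 'h) \<Rightarrow> bool"
  where "cuntz_rep N S \<longleftrightarrow>
    (\<forall>i<N. bounded_clinear (S i) \<and> (\<forall>x. norm (S i x) = norm x)) \<and>
    (\<forall>i<N. \<forall>j<N. \<forall>x. cadjoint (S i) (S j x) = (if i = j then x else 0)) \<and>
    (\<forall>x. (\<Sum>i<N. S i (cadjoint (S i) x)) = x)"

definition word_op :: "(nat \<Rightarrow> 'h \<Rightarrow> 'h) \<Rightarrow> nat list \<Rightarrow> 'h \<Rightarrow> 'h"
  where "word_op S I = foldr (\<lambda>i T. S i \<circ> T) I id"

definition monic_rep :: "nat \<Rightarrow> (nat \<Rightarrow> 'h::complex_hilbert \<Rightarrow> 'h) \<Rightarrow> bool"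
  where "monic_rep N S \<longleftrightarrow>
    (\<exists>\<phi>. closure (cspan {word_op S I (cadjoint (word_op S I) \<phi>) | I. I \<in> finite_words N}) = UNIV)"

text \<open>Countable additivity is with respect to the strong operator topology. The values of \<open>P\<close>
  outside \<open>sets M\<close> are irrelevant.\<close>

definition projection_valued_measure ::
    "'a measure \<Rightarrow> ('a set \<Rightarrow> 'h::complex_hilbert \<Rightarrow> 'h) \<Rightarrow> bool"
  where "projection_valued_measure M P \<longleftrightarrow>
    (\<forall>A\<in>sets M. orthogonal_projection (P A)) \<and>
    (\<forall>x. P {} x = 0) \<and>
    (\<forall>x. P (space M) x = x) \<and>
    (\<forall>A\<in>sets M. \<forall>B\<in>sets M. \<forall>x. P (A \<inter> B) x = P A (P B x)) \<and>
    (\<forall>A :: nat \<Rightarrow> 'a set. range A \<subseteq> sets M \<and> disjoint_family A \<longrightarrow>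
      (\<forall>x. (\<lambda>n. P (A n) x) sums P (\<Union>n. A n) x))"

definition associated_pvm ::
    "nat \<Rightarrow> (nat \<Rightarrow> 'h::complex_hilbert \<Rightarrow> 'h) \<Rightarrow> ((nat \<Rightarrow> nat) set \<Rightarrow> 'h \<Rightarrow> 'h) \<Rightarrow> bool"
  where "associated_pvm N S P \<longleftrightarrow>
    projection_valued_measure (word_borel N) P \<and>
    (\<forall>I\<in>finite_words N. \<forall>x. P (cylinder N I) x = word_op S I (cadjoint (word_op S I) x))"

text \<open>The representation with associated projection valued measure \<open>P\<close> is atomic. The sum of
  projections is taken in the strong operator topology.\<close>

definition atomic_pvm :: "nat \<Rightarrow> ((nat \<Rightarrow> nat) set \<Rightarrow> 'h::complex_hilbert \<Rightarrow> 'h) \<Rightarrow> bool"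
  where "atomic_pvm N P \<longleftrightarrow> (\<exists>\<Omega>\<subseteq>words N. \<forall>x. ((\<lambda>\<omega>. P {\<omega>} x) has_sum x) \<Omega>)"

definition atoms :: "nat \<Rightarrow> ((nat \<Rightarrow> nat) set \<Rightarrow> 'h::complex_hilbert \<Rightarrow> 'h) \<Rightarrow> (nat \<Rightarrow> nat) set"
  where "atoms N P = {\<omega> \<in> words N. P {\<omega>} \<noteq> (\<lambda>x. 0)}"


section \<open>Monic systems\<close>

text \<open>Elements of \<open>L\<^sup>2(\<mu>)\<close> are represented by functions; they are only compared almost everywhere.\<close>

definition square_integrable :: "'a measure \<Rightarrow> ('a \<Rightarrow> complex) set"
  where "square_integrable \<mu> =
    {g \<in> borel_measurable \<mu>. integrable \<mu> (\<lambda>\<omega>. (norm (g \<omega>))\<^sup>2)}"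

definition monic_system :: "nat \<Rightarrow> (nat \<Rightarrow> nat) measure \<Rightarrow> (nat \<Rightarrow> (nat \<Rightarrow> nat) \<Rightarrow> complex) \<Rightarrow> bool"
  where "monic_system N \<mu> f \<longleftrightarrow>
    finite_measure \<mu> \<and> sets \<mu> = sets (word_borel N) \<and>
    (\<forall>i<N.
      absolutely_continuous \<mu> (distr \<mu> (word_borel N) (prepend i)) \<and>
      f i \<in> square_integrable \<mu> \<and>
      distr \<mu> (word_borel N) (prepend i) = density \<mu> (\<lambda>\<omega>. ennreal ((norm (f i \<omega>))\<^sup>2)) \<and>
      (AE \<omega> in \<mu>. \<omega> \<in> prepend i ` words N \<longrightarrow> f i \<omega> \<noteq> 0))"

definition system_op ::
    "(nat \<Rightarrow> (nat \<Rightarrow> nat) \<Rightarrow> complex) \<Rightarrow> nat \<Rightarrow> ((nat \<Rightarrow> nat) \<Rightarrow> complex) \<Rightarrow> (nat \<Rightarrow> nat) \<Rightarrow> complex"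
  where "system_op f i g = (\<lambda>\<omega>. f i \<omega> * g (shift \<omega>))"

text \<open>\<open>U\<close> induces a unitary operator onto \<open>L\<^sup>2(\<mu>)\<close>.\<close>

definition unitary_onto_L2 :: "'a measure \<Rightarrow> ('h::complex_hilbert \<Rightarrow> 'a \<Rightarrow> complex) \<Rightarrow> bool"
  where "unitary_onto_L2 \<mu> U \<longleftrightarrow>
    (\<forall>x. U x \<in> square_integrable \<mu>) \<and>
    (\<forall>x y. AE \<omega> in \<mu>. U (x + y) \<omega> = U x \<omega> + U y \<omega>) \<and>
    (\<forall>c x. AE \<omega> in \<mu>. U (c *\<^sub>C x) \<omega> = c * U x \<omega>) \<and>
    (\<forall>x y. cinner x y = (LINT \<omega>|\<mu>. U x \<omega> * cnj (U y \<omega>))) \<and>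
    (\<forall>g\<in>square_integrable \<mu>. \<exists>x. AE \<omega> in \<mu>. U x \<omega> = g \<omega>)"

definition equivalent_to_system ::
    "nat \<Rightarrow> (nat \<Rightarrow> 'h::complex_hilbert \<Rightarrow> 'h) \<Rightarrow> (nat \<Rightarrow> nat) measure \<Rightarrow>
      (nat \<Rightarrow> (nat \<Rightarrow> nat) \<Rightarrow> complex) \<Rightarrow> bool"
  where "equivalent_to_system N S \<mu> f \<longleftrightarrow>
    (\<exists>U. unitary_onto_L2 \<mu> U \<and>
      (\<forall>i<N. \<forall>x. AE \<omega> in \<mu>. U (S i x) \<omega> = system_op f i (U x) \<omega>))"

text \<open>\<open>\<mu>\<close> is a sum of point masses.\<close>

definition atomic_measure :: "'a measure \<Rightarrow> bool"
  where "atomic_measure \<mu> \<longleftrightarrow>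
    (\<exists>\<Omega>\<subseteq>space \<mu>. \<forall>A\<in>sets \<mu>. ((\<lambda>\<omega>. emeasure \<mu> {\<omega>}) has_sum emeasure \<mu> A) (A \<inter> \<Omega>))"

definition measure_atoms :: "'a measure \<Rightarrow> 'a set"
  where "measure_atoms \<mu> = {\<omega> \<in> space \<mu>. emeasure \<mu> {\<omega>} \<noteq> 0}"

end

theory Submission
  imports Defs
begin

text \<open>A cyclic vector \<open>\<phi>\<close> makes each \<open>P {\<omega>}\<close> at most one-dimensional, because
  \<open>P {\<omega>}\<close> maps every \<open>P (cylinder N I) \<phi>\<close> to \<open>P {\<omega>} \<phi>\<close> or \<open>0\<close>. Conversely, if every atom is
  one-dimensional, take \<open>\<phi> = \<Sum> 2\<^bsup>-n(\<omega>)\<^esup> v(\<omega>)\<close> with a unit vector \<open>v(\<omega>)\<close> for each of the countably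
  many atoms: cylinders shrinking to \<open>\<omega>\<close> recover \<open>P {\<omega>} \<phi>\<close>, hence every \<open>v(\<omega>)\<close>.

  In the space \<open>L\<^sup>2(\<mu>)\<close> of an equivalent monic system the functions in the range of \<open>word_op S I\<close>
  vanish outside the cylinder of \<open>I\<close>, so the projection of the constant function \<open>1\<close> to that range
  is the indicator of the cylinder. If \<open>x\<close> is the vector corresponding to \<open>1\<close>, then \<open>\<mu>\<close> and
  \<open>A \<mapsto> \<parallel>P A x\<parallel>\<^sup>2\<close> agree on cylinders, hence on points, and \<open>\<parallel>x\<parallel>\<^sup>2 = \<mu>(words N)\<close> is the sum of
  the \<open>\<mu>{\<omega>}\<close> over the atoms.\<close>


section \<open>Complex Hilbert spaces\<close>

lemma cinner_zero_left [simp]: "cinner 0 (x :: 'a::complex_hilbert) = 0"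
  using cinner_add_left[of 0 0 x] by simp

lemma cinner_zero_right [simp]: "cinner (x :: 'a::complex_hilbert) 0 = 0"
  using cinner_commute[of x 0] by simp

lemma cinner_add_right: "cinner (x :: 'a::complex_hilbert) (y + z) = cinner x y + cinner x z"
  by (metis cinner_add_left cinner_commute complex_cnj_add)

lemma norm_add_square_orthogonal:
  fixes x y :: "'a::complex_hilbert"
  assumes "cinner x y = 0"
  shows "(norm (x + y))\<^sup>2 = (norm x)\<^sup>2 + (norm y)\<^sup>2"
proof -
  have "cinner y x = 0"
    using assms cinner_commute[of y x] by simp
  then have "cinner (x + y) (x + y) = cinner x x + cinner y y"
    using assms by (simp add: cinner_add_left cinner_add_right)
  then have "complex_of_real ((norm (x + y))\<^sup>2) = complex_of_real ((norm x)\<^sup>2 + (norm y)\<^sup>2)"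
    unfolding cinner_self by simp
  then show ?thesis
    by (simp only: of_real_eq_iff)
qed

lemma cinner_sum_left: "cinner (\<Sum>a\<in>F. f a) (y :: 'a::complex_hilbert) = (\<Sum>a\<in>F. cinner (f a) y)"
  by (induction F rule: infinite_finite_induct) (auto simp: cinner_add_left)

lemma norm_sum_square_orthogonal:
  fixes f :: "'b \<Rightarrow> 'a::complex_hilbert"
  assumes "finite F" "\<And>a b. a \<in> F \<Longrightarrow> b \<in> F \<Longrightarrow> a \<noteq> b \<Longrightarrow> cinner (f a) (f b) = 0"
  shows "(norm (\<Sum>a\<in>F. f a))\<^sup>2 = (\<Sum>a\<in>F. (norm (f a))\<^sup>2)"
  using assms
proof (induction F rule: finite_induct)
  case (insert b F)
  have "cinner (\<Sum>a\<in>F. f a) (f b) = 0"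
    unfolding cinner_sum_left using insert by (intro sum.neutral) auto
  then have "cinner (f b) (\<Sum>a\<in>F. f a) = 0"
    using cinner_commute[of "f b" "\<Sum>a\<in>F. f a"] by simp
  then show ?case
    using insert by (simp add: norm_add_square_orthogonal)
qed simp

text \<open>Pythagoras for finite partial sums passes to the limit because the norm is
  continuous.\<close>

lemma has_sum_norm_square_orthogonal:
  fixes f :: "'b \<Rightarrow> 'a::complex_hilbert"
  assumes "(f has_sum x) A" "\<And>a b. a \<in> A \<Longrightarrow> b \<in> A \<Longrightarrow> a \<noteq> b \<Longrightarrow> cinner (f a) (f b) = 0"
  shows "((\<lambda>a. (norm (f a))\<^sup>2) has_sum (norm x)\<^sup>2) A"
proof -
  have "((\<lambda>F. (norm (sum f F))\<^sup>2) \<longlongrightarrow> (norm x)\<^sup>2) (finite_subsets_at_top A)"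
    using assms(1) unfolding has_sum_def by (intro tendsto_intros)
  moreover have "\<forall>\<^sub>F F in finite_subsets_at_top A. (norm (sum f F))\<^sup>2 = (\<Sum>a\<in>F. (norm (f a))\<^sup>2)"
    by (rule eventually_finite_subsets_at_top_weakI)
      (intro norm_sum_square_orthogonal, auto intro: assms(2))
  ultimately show ?thesis
    unfolding has_sum_def by (rule Lim_transform_eventually)
qed

text \<open>The norm axioms speak of real scalars only; the complex case is read off from
  \<open>cinner_self\<close>.\<close>

lemma norm_scaleC: "norm (c *\<^sub>C (x :: 'a::complex_hilbert)) = norm c * norm x"
proof -
  have "cinner (c *\<^sub>C x) (c *\<^sub>C x) = c * cnj (c * cinner x x)"
    by (metis cinner_commute cinner_scaleC_left)
  also have "\<dots> = complex_of_real ((norm c * norm x)\<^sup>2)"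
    by (simp add: cinner_self power_mult_distrib complex_norm_square[unfolded of_real_power])
  finally have "(norm (c *\<^sub>C x))\<^sup>2 = (norm c * norm x)\<^sup>2"
    unfolding cinner_self by (simp only: of_real_eq_iff)
  then show ?thesis
    by (rule power2_eq_imp_eq) auto
qed

lemma bounded_linear_scaleC_right: "bounded_linear (\<lambda>x :: 'a::complex_hilbert. c *\<^sub>C x)"
proof (rule bounded_linear_intro[where K = "norm c"])
  show "c *\<^sub>C (r *\<^sub>R x) = r *\<^sub>R (c *\<^sub>C x)" for r and x :: 'a
    by (simp add: scaleR_scaleC scaleC_scaleC mult.commute)
qed (auto simp: scaleC_add_right norm_scaleC)

lemma bounded_linear_scaleC_left: "bounded_linear (\<lambda>c. c *\<^sub>C (x :: 'a::complex_hilbert))"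
proof (rule bounded_linear_intro[where K = "norm x"])
  show "(r *\<^sub>R c) *\<^sub>C x = r *\<^sub>R (c *\<^sub>C x)" for r c
    by (simp add: scaleR_scaleC scaleC_scaleC scaleC_complex_def)
qed (auto simp: scaleC_add_left norm_scaleC)

text \<open>For \<open>x \<noteq> 0\<close> the map \<open>c \<mapsto> c *\<^sub>C x\<close>
  multiplies distances by \<open>norm x\<close>, so the line inherits completeness from the complex
  plane.\<close>

lemma closed_cspan_singleton: "closed (cspan {x :: 'a::complex_hilbert})"
proof (cases "x = 0")
  case False
  have "complete ((\<lambda>c. c *\<^sub>C x) ` UNIV)"
    by (rule complete_isometric_image[where e = "norm x"])
      (use False in \<open>auto simp: bounded_linear_scaleC_left norm_scaleC\<close>)
  then show ?thesis
    by (simp add: complex_vector.span_singleton complete_eq_closed)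
qed simp

text \<open>An infinite set has \<open>card\<close> 0, so the value 1 really forces a basis with
  exactly one element.\<close>

lemma cdim_eq_1_iff:
  assumes "complex_vector.subspace (V :: 'a::complex_hilbert set)"
  shows "cdim V = 1 \<longleftrightarrow> (\<exists>v. v \<noteq> 0 \<and> V = cspan {v})"
proof
  assume "cdim V = 1"
  moreover obtain B where B: "B \<subseteq> V" "\<not> complex_vector.dependent B" "V \<subseteq> cspan B" "card B = cdim V"
    by (rule complex_vector.basis_exists)
  ultimately obtain v where v: "B = {v}"
    by (metis card_1_singletonE)
  then have "v \<noteq> 0"
    using B(2) complex_vector.dependent_zero[of B] by auto
  moreover have "V = cspan {v}"
    using B(1,3) v assms complex_vector.span_minimal by (metis subset_antisym)
  ultimately show "\<exists>v. v \<noteq> 0 \<and> V = cspan {v}"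
    by blast
next
  assume "\<exists>v. v \<noteq> 0 \<and> V = cspan {v}"
  then obtain v where v: "v \<noteq> 0" "V = cspan {v}"
    by blast
  then have "\<not> complex_vector.dependent {v}"
    by (simp add: complex_vector.dependent_single)
  then show "cdim V = 1"
    unfolding v(2) using complex_vector.dim_span_eq_card_independent[of "{v}"] by simp
qed

lemma csubspace_closure:
  assumes "complex_vector.subspace (V :: 'a::complex_hilbert set)"
  shows "complex_vector.subspace (closure V)"
proof (rule complex_vector.subspaceI)
  show "0 \<in> closure V"
    using complex_vector.subspace_0[OF assms] closure_subset by blast
  show "x + y \<in> closure V" if "x \<in> closure V" "y \<in> closure V" for x y
  proof -
    obtain f g where "\<And>n. f n \<in> V" "f \<longlonglongrightarrow> x" "\<And>n. g n \<in> V" "g \<longlonglongrightarrow> y"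
      using \<open>x \<in> closure V\<close> \<open>y \<in> closure V\<close> unfolding closure_sequential by blast
    then have "(\<forall>n. f n + g n \<in> V) \<and> (\<lambda>n. f n + g n) \<longlonglongrightarrow> x + y"
      using assms by (auto intro: complex_vector.subspace_add tendsto_add)
    then show ?thesis
      unfolding closure_sequential by (intro exI[where x = "\<lambda>n. f n + g n"])
  qed
  show "c *\<^sub>C x \<in> closure V" if "x \<in> closure V" for c x
  proof -
    obtain f where "\<And>n. f n \<in> V" "f \<longlonglongrightarrow> x"
      using \<open>x \<in> closure V\<close> unfolding closure_sequential by blast
    then have "(\<forall>n. c *\<^sub>C f n \<in> V) \<and> (\<lambda>n. c *\<^sub>C f n) \<longlonglongrightarrow> c *\<^sub>C x"
      using assms bounded_linear.tendsto[OF bounded_linear_scaleC_right]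
      by (auto intro: complex_vector.subspace_scale)
    then show ?thesis
      unfolding closure_sequential by (intro exI[where x = "\<lambda>n. c *\<^sub>C f n"])
  qed
qed

lemma has_sum_in_closed_csubspace:
  fixes f :: "'b \<Rightarrow> 'a::complex_hilbert"
  assumes "complex_vector.subspace V" "closed V" "(f has_sum x) A" "\<And>a. a \<in> A \<Longrightarrow> f a \<in> V"
  shows "x \<in> V"
proof (rule Lim_in_closed_set[OF \<open>closed V\<close>])
  show "(sum f \<longlongrightarrow> x) (finite_subsets_at_top A)"
    using assms(3) by (simp add: has_sum_def)
  show "\<forall>\<^sub>F F in finite_subsets_at_top A. sum f F \<in> V"
    by (rule eventually_finite_subsets_at_top_weakI)
      (use assms(1,4) in \<open>auto intro: complex_vector.subspace_sum\<close>)
qed simp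


section \<open>Projection valued measures\<close>

locale pvm =
  fixes M :: "'a measure" and P :: "'a set \<Rightarrow> 'h::complex_hilbert \<Rightarrow> 'h"
  assumes pvm: "projection_valued_measure M P"
begin

lemma projection: "A \<in> sets M \<Longrightarrow> orthogonal_projection (P A)"
  using pvm by (simp add: projection_valued_measure_def)

lemma clinear: "A \<in> sets M \<Longrightarrow> bounded_clinear (P A)"
  using projection by (simp add: orthogonal_projection_def)

lemma linear: "A \<in> sets M \<Longrightarrow> bounded_linear (P A)"
  using clinear by (simp add: bounded_clinear_def)

lemma scaleC: "A \<in> sets M \<Longrightarrow> P A (c *\<^sub>C x) = c *\<^sub>C P A x"
  using clinear by (simp add: bounded_clinear_def)

lemma empty: "P {} x = 0"
  using pvm by (simp add: projection_valued_measure_def)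

lemma space: "P (space M) x = x"
  using pvm by (simp add: projection_valued_measure_def)

lemma Int: "A \<in> sets M \<Longrightarrow> B \<in> sets M \<Longrightarrow> P (A \<inter> B) x = P A (P B x)"
  using pvm by (simp add: projection_valued_measure_def)

lemma sums: "range A \<subseteq> sets M \<Longrightarrow> disjoint_family A \<Longrightarrow> (\<lambda>n. P (A n) x) sums P (\<Union>n. A n) x"
  using pvm by (auto simp: projection_valued_measure_def)

text \<open>Self-adjointness moves \<open>P A\<close> to the other side, where it meets
  \<open>P B\<close> in \<open>P {}\<close>.\<close>

lemma orthogonal:
  assumes "A \<in> sets M" "B \<in> sets M" "A \<inter> B = {}"
  shows "cinner (P A x) (P B y) = 0"
proof -
  have "cinner (P A x) (P B y) = cinner x (P A (P B y))"
    using projection[OF assms(1)] by (simp add: orthogonal_projection_def)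
  also have "\<dots> = 0"
    using Int[OF assms(1,2), of y] assms(3) empty by simp
  finally show ?thesis .
qed

text \<open>Finite additivity is countable additivity for the sequence
  \<open>A, B, {}, {}, ...\<close>.\<close>

lemma Un_disjoint:
  assumes "A \<in> sets M" "B \<in> sets M" "A \<inter> B = {}"
  shows "P (A \<union> B) x = P A x + P B x"
proof -
  have "(\<lambda>n. P (binaryset A B n) x) sums P (\<Union>n. binaryset A B n) x"
    using assms by (intro sums) (auto simp: range_binaryset_eq disjoint_family_on_def binaryset_def)
  moreover have "(\<lambda>n. P (binaryset A B n) x) sums (P A x + P B x)"
    using binaryset_sums[of "\<lambda>A. P A x" A B] by (simp add: empty)
  ultimately show ?thesis
    by (simp add: UN_binaryset_eq sums_unique2)
qed

lemma Diff:
  assumes "A \<in> sets M" "B \<in> sets M" "B \<subseteq> A"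
  shows "P (A - B) x = P A x - P B x"
proof -
  have "P (B \<union> (A - B)) x = P B x + P (A - B) x"
    using assms by (intro Un_disjoint) auto
  moreover have "B \<union> (A - B) = A"
    using assms(3) by auto
  ultimately show ?thesis
    by simp
qed

lemma UN_finite:
  assumes "finite I" "\<And>i. i \<in> I \<Longrightarrow> A i \<in> sets M" "disjoint_family_on A I"
  shows "P (\<Union>i\<in>I. A i) x = (\<Sum>i\<in>I. P (A i) x)"
  using assms
proof (induction I rule: finite_induct)
  case (insert i I)
  then have "P (A i \<union> (\<Union>i\<in>I. A i)) x = P (A i) x + P (\<Union>i\<in>I. A i) x"
    by (intro Un_disjoint) (auto simp: disjoint_family_on_def)
  moreover have "P (\<Union>i\<in>I. A i) x = (\<Sum>i\<in>I. P (A i) x)"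
    using insert by (simp add: disjoint_family_on_def)
  ultimately show ?case
    using insert by simp
qed (simp add: empty)

text \<open>Continuity from above in the strong topology. It ties the projection of a point to the
  cylinders shrinking to it.\<close>

lemma LIMSEQ_decseq:
  assumes A: "range A \<subseteq> sets M" "decseq A"
  shows "(\<lambda>n. P (A n) x) \<longlonglongrightarrow> P (\<Inter>n. A n) x"
proof -
  \<comment> \<open>\<open>D n\<close> is the layer lost between \<open>A n\<close> and
    \<open>A (Suc n)\<close>. The layers are disjoint with union
    \<open>A 0 - (\<Inter>n. A n)\<close>, and their partial sums telescope.\<close>
  define D where "D n = A n - A (Suc n)" for n
  have sub: "A n \<subseteq> A m" if "m \<le> n" for m n
    using decseqD[OF A(2) that] .
  have "D m \<inter> D n = {}" if "m < n" for m n
    using sub[of "Suc m" n] that by (auto simp: D_def)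
  then have "disjoint_family D"
    unfolding disjoint_family_on_def by (metis Int_commute linorder_neqE_nat)
  moreover have "range D \<subseteq> sets M"
    using A(1) by (auto simp: D_def)
  ultimately have "(\<lambda>n. P (D n) x) sums P (\<Union>n. D n) x"
    by (intro sums)
  moreover have "(\<Sum>k<n. P (D k) x) = P (A 0) x - P (A n) x" for n
    by (induction n) (use A sub in \<open>auto simp: D_def Diff\<close>)
  moreover have UN: "(\<Union>n. D n) = A 0 - (\<Inter>n. A n)"
  proof -
    have "\<exists>k. y \<in> D k" if "y \<in> A 0" "y \<notin> A n" for n y
      using that by (induction n) (auto simp: D_def)
    moreover have "A n \<subseteq> A 0" for n
      using sub by simp
    ultimately show ?thesis
      by (fastforce simp: D_def)
  qed
  moreover have "(\<Inter>n. A n) \<in> sets M"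
    using A(1) by auto
  then have "P (A 0 - (\<Inter>n. A n)) x = P (A 0) x - P (\<Inter>n. A n) x"
    using A(1) by (intro Diff) auto
  ultimately have "(\<lambda>n. P (A 0) x - P (A n) x) \<longlonglongrightarrow> P (A 0) x - P (\<Inter>n. A n) x"
    by (simp add: sums_def)
  from tendsto_diff[OF tendsto_const[of "P (A 0) x"] this] show ?thesis
    by simp
qed

lemma csubspace_range:
  assumes "A \<in> sets M"
  shows "complex_vector.subspace (range (P A))"
proof (rule complex_vector.subspaceI)
  interpret bounded_linear "P A" by (rule linear[OF assms])
  show "0 \<in> range (P A)"
    using zero by (metis rangeI)
  show "x + y \<in> range (P A)" if "x \<in> range (P A)" "y \<in> range (P A)" for x y
    using that by (auto simp: add[symmetric])
  show "c *\<^sub>C x \<in> range (P A)" if "x \<in> range (P A)" for c x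
    using that by (auto simp: scaleC[OF assms, symmetric])
qed

end


section \<open>Infinite words\<close>

lemma space_word_borel [simp]: "space (word_borel N) = words N"
  by (simp add: word_borel_def space_measure_of_conv)

lemma openin_word_borel: "openin (word_topology N) U \<Longrightarrow> U \<in> sets (word_borel N)"
  using openin_subset[of "word_topology N"] unfolding word_borel_def topspace_word_topology
  by (subst sets_measure_of) auto

lemma measurable_word_borelI:
  assumes "continuous_map (word_topology N) (word_topology N) g"
  shows "g \<in> measurable (word_borel N) (word_borel N)"
proof -
  have "g \<in> measurable (word_borel N) (sigma (words N) {U. openin (word_topology N) U})"
  proof (rule measurable_measure_of)
    show "{U. openin (word_topology N) U} \<subseteq> Pow (words N)"
      using openin_subset topspace_word_topology by fastforce
    show "g \<in> space (word_borel N) \<rightarrow> words N"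
      using continuous_map_image_subset_topspace[OF assms] by (auto simp: topspace_word_topology)
    fix U assume "U \<in> {U. openin (word_topology N) U}"
    then have "openin (word_topology N) {x \<in> topspace (word_topology N). g x \<in> U}"
      using assms openin_continuous_map_preimage by blast
    moreover have "{x \<in> topspace (word_topology N). g x \<in> U} = g -` U \<inter> space (word_borel N)"
      by (auto simp: topspace_word_topology)
    ultimately show "g -` U \<inter> space (word_borel N) \<in> sets (word_borel N)"
      by (simp add: openin_word_borel)
  qed
  then show ?thesis
    by (simp add: word_borel_def)
qed

lemma continuous_map_letter: "continuous_map (word_topology N) (discrete_topology {..<N}) (\<lambda>\<omega>. \<omega> k)"
  unfolding word_topology_def by (rule continuous_map_product_projection) simp

lemma measurable_shift [measurable]: "shift \<in> measurable (word_borel N) (word_borel N)"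
proof (rule measurable_word_borelI)
  have "continuous_map (word_topology N) (word_topology N) (\<lambda>\<omega> k. \<omega> (Suc k))"
    by (subst (2) word_topology_def) (simp add: continuous_map_componentwise_UNIV continuous_map_letter)
  then show "continuous_map (word_topology N) (word_topology N) shift"
    by (simp add: shift_def[abs_def])
qed

lemma measurable_prepend [measurable]:
  assumes "i < N"
  shows "prepend i \<in> measurable (word_borel N) (word_borel N)"
proof (rule measurable_word_borelI)
  have "continuous_map (word_topology N) (discrete_topology {..<N})
      (\<lambda>\<omega>. case k of 0 \<Rightarrow> i | Suc m \<Rightarrow> \<omega> m)" for k
    using assms by (cases k) (simp_all add: continuous_map_letter)
  then have "continuous_map (word_topology N) (word_topology N)
      (\<lambda>\<omega> k. case k of 0 \<Rightarrow> i | Suc m \<Rightarrow> \<omega> m)"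
    by (subst (2) word_topology_def) (simp add: continuous_map_componentwise_UNIV)
  then show "continuous_map (word_topology N) (word_topology N) (prepend i)"
    by (simp add: prepend_def[abs_def])
qed

lemma measurable_letter [measurable]: "(\<lambda>\<omega>. \<omega> k) \<in> measurable (word_borel N) (count_space UNIV)"
proof (rule measurableI)
  fix A :: "nat set"
  \<comment> \<open>\<open>A\<close> is cut down to \<open>{..<N}\<close> because open sets of the
    discrete letter space consist of letters only.\<close>
  have "openin (word_topology N) {\<omega> \<in> topspace (word_topology N). \<omega> k \<in> A \<inter> {..<N}}"
    by (rule openin_continuous_map_preimage[OF continuous_map_letter]) simp
  moreover have "{\<omega> \<in> topspace (word_topology N). \<omega> k \<in> A \<inter> {..<N}} =
      (\<lambda>\<omega>. \<omega> k) -` A \<inter> space (word_borel N)"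
    by (auto simp: topspace_word_topology words_def)
  ultimately show "(\<lambda>\<omega>. \<omega> k) -` A \<inter> space (word_borel N) \<in> sets (word_borel N)"
    by (simp add: openin_word_borel)
qed simp

lemma sets_cylinder [measurable]: "cylinder N I \<in> sets (word_borel N)"
proof -
  have "{\<omega> \<in> space (word_borel N). \<omega> k = I ! k} \<in> sets (word_borel N)" for k
    using measurable_sets[OF measurable_letter, of "{I ! k}" k N]
    by (simp add: vimage_def Int_def conj_commute)
  then have "{\<omega> \<in> space (word_borel N). \<forall>k\<in>{..<length I}. \<omega> k = I ! k} \<in> sets (word_borel N)"
    by (intro sets.sets_Collect_finite_All) auto
  moreover have "cylinder N I = {\<omega> \<in> space (word_borel N). \<forall>k\<in>{..<length I}. \<omega> k = I ! k}"
    by (auto simp: cylinder_def)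
  ultimately show ?thesis
    by (simp only:)
qed

lemma cylinder_Nil [simp]: "cylinder N [] = words N"
  by (simp add: cylinder_def)

lemma mem_cylinder_Cons:
  assumes "\<omega> \<in> words N"
  shows "\<omega> \<in> cylinder N (i # I) \<longleftrightarrow> \<omega> 0 = i \<and> shift \<omega> \<in> cylinder N I"
  using assms by (auto simp: cylinder_def words_def shift_def All_less_Suc2)

lemma cylinder_snoc: "cylinder N (I @ [j]) = {\<omega> \<in> cylinder N I. \<omega> (length I) = j}"
  by (auto simp: cylinder_def All_less_Suc nth_append)

text \<open>Refinement by one more letter at the end; it drives the induction in
  \<open>U_P_cylinder\<close>.\<close>

lemma cylinder_eq_UN_snoc: "cylinder N I = (\<Union>j<N. cylinder N (I @ [j]))"
  by (auto simp: cylinder_snoc) (auto simp: cylinder_def words_def)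

lemma prefix_in_finite_words: "\<omega> \<in> words N \<Longrightarrow> map \<omega> [0..<n] \<in> finite_words N"
  by (auto simp: finite_words_def words_def)

lemma decseq_cylinder_prefix: "decseq (\<lambda>n. cylinder N (map \<omega> [0..<n]))"
  by (auto simp: decseq_def cylinder_def)

lemma INT_cylinder_prefix:
  assumes "\<omega> \<in> words N"
  shows "(\<Inter>n. cylinder N (map \<omega> [0..<n])) = {\<omega>}"
proof (intro equalityI subsetI)
  fix \<omega>' assume "\<omega>' \<in> (\<Inter>n. cylinder N (map \<omega> [0..<n]))"
  \<comment> \<open>Letters are counted from 0, so a prefix of length \<open>Suc k\<close> is needed
    to fix letter \<open>k\<close>.\<close>
  then have "\<omega>' \<in> cylinder N (map \<omega> [0..<Suc k])" for k
    by blast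
  then have "\<omega>' k = \<omega> k" for k
    unfolding cylinder_def by (auto simp del: upt_Suc)
  then show "\<omega>' \<in> {\<omega>}"
    by auto
qed (use assms in \<open>simp add: cylinder_def\<close>)

lemma sets_word_singleton:
  assumes "\<omega> \<in> words N"
  shows "{\<omega>} \<in> sets (word_borel N)"
proof -
  have "(\<Inter>n. cylinder N (map \<omega> [0..<n])) \<in> sets (word_borel N)"
    by measurable
  then show ?thesis
    using assms by (simp add: INT_cylinder_prefix)
qed


section \<open>Atomic representations\<close>

locale atomic_rep =
  fixes N :: nat
    and S :: "nat \<Rightarrow> 'h::complex_hilbert \<Rightarrow> 'h"
    and P :: "(nat \<Rightarrow> nat) set \<Rightarrow> 'h \<Rightarrow> 'h"
  assumes associated: "associated_pvm N S P"
    and atomic: "atomic_pvm N P"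
begin

sublocale pvm "word_borel N" P
  using associated by unfold_locales (simp add: associated_pvm_def)

lemma P_cylinder: "I \<in> finite_words N \<Longrightarrow> P (cylinder N I) x = word_op S I (cadjoint (word_op S I) x)"
  using associated by (simp add: associated_pvm_def)

text \<open>The intersection of \<open>{\<omega>}\<close> with \<open>A\<close> is
  \<open>{\<omega>}\<close> or empty, so multiplicativity leaves only these two values.\<close>

lemma P_singleton_mult:
  assumes "\<omega> \<in> words N" "A \<in> sets (word_borel N)"
  shows "P {\<omega>} (P A x) = (if \<omega> \<in> A then P {\<omega>} x else 0)"
  using Int[OF sets_word_singleton[OF assms(1)] assms(2), of x] empty
  by (cases "\<omega> \<in> A") auto

lemma P_prefix_LIMSEQ:
  assumes "\<omega> \<in> words N"
  shows "(\<lambda>n. P (cylinder N (map \<omega> [0..<n])) x) \<longlonglongrightarrow> P {\<omega>} x"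
proof -
  have "range (\<lambda>n. cylinder N (map \<omega> [0..<n])) \<subseteq> sets (word_borel N)"
    by (auto simp: sets_cylinder)
  then show ?thesis
    using LIMSEQ_decseq[OF _ decseq_cylinder_prefix, of N \<omega> x] assms
    by (simp add: INT_cylinder_prefix)
qed

lemma atoms_in_words: "\<omega> \<in> atoms N P \<Longrightarrow> \<omega> \<in> words N"
  by (simp add: atoms_def)

text \<open>The set \<Omega> from \<open>atomic_pvm\<close> can be replaced by the set of atoms: the
  two differ only in points whose projection is zero.\<close>

lemma sum_atoms: "((\<lambda>\<omega>. P {\<omega>} x) has_sum x) (atoms N P)"
proof -
  obtain \<Omega> where \<Omega>: "\<Omega> \<subseteq> words N" "\<And>x. ((\<lambda>\<omega>. P {\<omega>} x) has_sum x) \<Omega>"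
    using atomic by (auto simp: atomic_pvm_def)
  \<comment> \<open>Expanding the vector \<open>P {\<omega>} y\<close> over \<Omega> gives only zero
    terms, since every point of \<Omega> differs from \<omega>.\<close>
  have "P {\<omega>} y = 0" if "\<omega> \<in> words N" "\<omega> \<notin> \<Omega>" for \<omega> y
  proof -
    have "P {\<omega>'} (P {\<omega>} y) = 0" if "\<omega>' \<in> \<Omega>" for \<omega>'
      using that \<Omega>(1) \<open>\<omega> \<in> words N\<close> \<open>\<omega> \<notin> \<Omega>\<close>
      by (subst P_singleton_mult) (auto simp: sets_word_singleton)
    then have "((\<lambda>_. 0) has_sum P {\<omega>} y) \<Omega>"
      using \<Omega>(2)[of "P {\<omega>} y"] by (simp cong: has_sum_cong)
    then show ?thesis
      using has_sum_0_simp has_sum_unique by blast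
  qed
  then have "((\<lambda>\<omega>. P {\<omega>} x) has_sum x) \<Omega> = ((\<lambda>\<omega>. P {\<omega>} x) has_sum x) (atoms N P)"
    using \<Omega>(1) by (intro has_sum_cong_neutral) (auto simp: atoms_def)
  then show ?thesis
    using \<Omega>(2) by simp
qed

lemma orthogonal_singletons:
  assumes "\<omega> \<in> words N" "\<omega>' \<in> words N" "\<omega> \<noteq> \<omega>'"
  shows "cinner (P {\<omega>} x) (P {\<omega>'} y) = 0"
  using assms by (intro orthogonal) (auto simp: sets_word_singleton)

lemma norm_square_sum_atoms: "((\<lambda>\<omega>. (norm (P {\<omega>} x))\<^sup>2) has_sum (norm x)\<^sup>2) (atoms N P)"
  by (rule has_sum_norm_square_orthogonal[OF sum_atoms])
    (auto intro: orthogonal_singletons atoms_in_words)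

text \<open>Unit vectors in the ranges of different atoms are orthogonal, so their squared distance
  is 2. A countable dense set can approximate all of them only if there are countably many.\<close>

lemma countable_atoms:
  assumes "separable_space (euclidean :: 'h topology)"
  shows "countable (atoms N P)"
proof -
  obtain C :: "'h set" where C: "countable C" "closure C = UNIV"
    using assms by (auto simp: separable_space_def)
  have "\<exists>z. norm (P {\<omega>} z) = 1" if \<omega>: "\<omega> \<in> atoms N P" for \<omega>
  proof -
    obtain z where "P {\<omega>} z \<noteq> 0"
      using \<omega> by (auto simp: atoms_def)
    moreover have "bounded_linear (P {\<omega>})"
      using \<omega> by (intro linear sets_word_singleton atoms_in_words)
    ultimately have "norm (P {\<omega>} (z /\<^sub>R norm (P {\<omega>} z))) = 1"
      by (simp add: linear_simps)
    then show ?thesis ..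
  qed
  then obtain z where z: "\<And>\<omega>. \<omega> \<in> atoms N P \<Longrightarrow> norm (P {\<omega>} (z \<omega>)) = 1"
    by metis
  \<comment> \<open>The radius 1/2 suffices: a common approximant would put two of the unit vectors
    within distance 1, below the square root of 2.\<close>
  have "\<exists>c\<in>C. dist c (P {\<omega>} (z \<omega>)) < 1/2" for \<omega>
    using C(2) closure_approachable[THEN iffD1, rule_format, of _ C "1/2"] by simp
  then obtain c where c: "\<And>\<omega>. c \<omega> \<in> C" "\<And>\<omega>. dist (c \<omega>) (P {\<omega>} (z \<omega>)) < 1/2"
    by metis
  have "inj_on c (atoms N P)"
  proof (rule inj_onI, rule ccontr)
    fix \<omega> \<omega>' assume *: "\<omega> \<in> atoms N P" "\<omega>' \<in> atoms N P" "c \<omega> = c \<omega>'" "\<omega> \<noteq> \<omega>'"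
    have lin: "bounded_linear (P {\<omega>'})"
      using * by (intro linear sets_word_singleton atoms_in_words)
    \<comment> \<open>The minus sign inside \<open>P {\<omega>'}\<close> turns the difference of the
      unit vectors into an orthogonal sum.\<close>
    have "(norm (P {\<omega>} (z \<omega>) + P {\<omega>'} (- z \<omega>')))\<^sup>2 =
        (norm (P {\<omega>} (z \<omega>)))\<^sup>2 + (norm (P {\<omega>'} (- z \<omega>')))\<^sup>2"
      using * by (intro norm_add_square_orthogonal orthogonal_singletons atoms_in_words)
    then have "(dist (P {\<omega>} (z \<omega>)) (P {\<omega>'} (z \<omega>')))\<^sup>2 = 2"
      using * z lin by (simp add: linear_simps dist_norm)
    moreover have "dist (P {\<omega>} (z \<omega>)) (P {\<omega>'} (z \<omega>')) \<le> 1"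
      using c(2)[of \<omega>] c(2)[of \<omega>'] *(3) by metric
    then have "(dist (P {\<omega>} (z \<omega>)) (P {\<omega>'} (z \<omega>')))\<^sup>2 \<le> 1"
      by (simp add: power_le_one)
    ultimately show False
      by simp
  qed
  moreover have "countable (c ` atoms N P)"
    using c(1) by (intro countable_subset[OF _ C(1)]) auto
  ultimately show ?thesis
    by (rule countable_image_inj_on[rotated])
qed

section \<open>From a cyclic vector to one-dimensional atoms\<close>

lemma range_atom_of_cyclic:
  assumes "closure (cspan {word_op S I (cadjoint (word_op S I) \<phi>) | I. I \<in> finite_words N}) = UNIV"
    and "\<omega> \<in> words N"
  shows "range (P {\<omega>}) = cspan {P {\<omega>} \<phi>}"
proof -
  let ?G = "{word_op S I (cadjoint (word_op S I) \<phi>) | I. I \<in> finite_words N}"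
  \<comment> \<open>The vectors that \<open>P {\<omega>}\<close> sends into the line of
    \<open>P {\<omega>} \<phi>\<close> form a closed subspace containing the whole orbit of \<phi>,
    hence everything.\<close>
  let ?V = "P {\<omega>} -` cspan {P {\<omega>} \<phi>}"
  have \<omega>: "{\<omega>} \<in> sets (word_borel N)"
    using assms(2) by (rule sets_word_singleton)
  interpret P: bounded_linear "P {\<omega>}"
    by (rule linear[OF \<omega>])
  have "P (cylinder N I) \<phi> \<in> ?V" for I
    using assms(2) by (simp add: P_singleton_mult sets_cylinder complex_vector.span_base
        complex_vector.span_zero)
  then have "?G \<subseteq> ?V"
    by (force simp: P_cylinder[symmetric])
  moreover have "complex_vector.subspace ?V"
    by (rule complex_vector.subspaceI)
      (auto simp: P.zero P.add scaleC[OF \<omega>] intro: complex_vector.span_zero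
        complex_vector.span_add complex_vector.span_scale)
  ultimately have "cspan ?G \<subseteq> ?V"
    by (rule complex_vector.span_minimal)
  moreover have "closed ?V"
    by (intro continuous_closed_vimage closed_cspan_singleton) (simp add: linear_continuous_at linear \<omega>)
  ultimately have "range (P {\<omega>}) \<subseteq> cspan {P {\<omega>} \<phi>}"
    using assms(1) closure_minimal[of "cspan ?G" ?V] by auto
  moreover have "cspan {P {\<omega>} \<phi>} \<subseteq> range (P {\<omega>})"
    by (intro complex_vector.span_minimal csubspace_range \<omega>) auto
  ultimately show ?thesis
    by (rule antisym)
qed

lemma cdim_atom_of_monic:
  assumes "monic_rep N S" "\<omega> \<in> atoms N P"
  shows "cdim (range (P {\<omega>})) = 1"
proof -
  have \<omega>: "\<omega> \<in> words N"
    by (rule atoms_in_words) fact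
  obtain \<phi> where
    "closure (cspan {word_op S I (cadjoint (word_op S I) \<phi>) | I. I \<in> finite_words N}) = UNIV"
    using assms(1) unfolding monic_rep_def by blast
  note range = range_atom_of_cyclic[OF this \<omega>]
  \<comment> \<open>The spanning vector must be nonzero, since otherwise the range would be trivial
    and \<omega> not an atom.\<close>
  moreover have "P {\<omega>} \<phi> \<noteq> 0"
  proof
    assume "P {\<omega>} \<phi> = 0"
    then have "P {\<omega>} x = 0" for x
      using range by auto
    then show False
      using assms(2) by (auto simp: atoms_def)
  qed
  ultimately show ?thesis
    unfolding cdim_eq_1_iff[OF csubspace_range[OF sets_word_singleton[OF \<omega>]]] by (intro exI conjI)
qed

section \<open>From one-dimensional atoms to a cyclic vector\<close>

lemma closure_cspan_orbit_UNIV: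
  assumes "\<And>\<omega>. \<omega> \<in> atoms N P \<Longrightarrow> range (P {\<omega>}) \<subseteq> cspan {P {\<omega>} \<phi>}"
  shows "closure (cspan {word_op S I (cadjoint (word_op S I) \<phi>) | I. I \<in> finite_words N}) = UNIV"
    (is "closure (cspan ?G) = UNIV")
proof -
  have sub: "complex_vector.subspace (closure (cspan ?G))"
    by (intro csubspace_closure complex_vector.subspace_span)
  \<comment> \<open>Prefix cylinders put \<open>P {\<omega>} \<phi>\<close> into the closure, and
    its line covers the range of \<open>P {\<omega>}\<close>. Summing over the atoms then reaches
    every vector.\<close>
  have "P {\<omega>} x \<in> closure (cspan ?G)" if \<omega>: "\<omega> \<in> atoms N P" for \<omega> x
  proof -
    have "P {\<omega>} \<phi> \<in> closure (cspan ?G)"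
    proof (rule Lim_in_closed_set[OF closed_closure])
      show "(\<lambda>n. P (cylinder N (map \<omega> [0..<n])) \<phi>) \<longlonglongrightarrow> P {\<omega>} \<phi>"
        using \<omega> by (intro P_prefix_LIMSEQ atoms_in_words)
      have "P (cylinder N (map \<omega> [0..<n])) \<phi> \<in> ?G" for n
        using prefix_in_finite_words[OF atoms_in_words[OF \<omega>], of n] by (auto simp: P_cylinder)
      then have "P (cylinder N (map \<omega> [0..<n])) \<phi> \<in> closure (cspan ?G)" for n
        using closure_subset complex_vector.span_superset by fastforce
      then show "\<forall>\<^sub>F n in sequentially. P (cylinder N (map \<omega> [0..<n])) \<phi> \<in> closure (cspan ?G)"
        by simp
    qed simp
    then have "cspan {P {\<omega>} \<phi>} \<subseteq> closure (cspan ?G)"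
      by (intro complex_vector.span_minimal sub) simp
    then show ?thesis
      using assms[OF \<omega>] by auto
  qed
  then have "x \<in> closure (cspan ?G)" for x
    by (rule has_sum_in_closed_csubspace[OF sub closed_closure sum_atoms])
  then show ?thesis
    by auto
qed

lemma monic_of_cdim_atoms:
  assumes "countable (atoms N P)" "\<And>\<omega>. \<omega> \<in> atoms N P \<Longrightarrow> cdim (range (P {\<omega>})) = 1"
  shows "monic_rep N S"
proof -
  let ?A = "atoms N P"
  have "\<exists>v. v \<noteq> 0 \<and> range (P {\<omega>}) = cspan {v}" if "\<omega> \<in> ?A" for \<omega>
    using assms(2)[OF that] cdim_eq_1_iff[OF csubspace_range[OF sets_word_singleton[OF atoms_in_words[OF that]]]]
    by simp
  then obtain v where v: "\<And>\<omega>. \<omega> \<in> ?A \<Longrightarrow> v \<omega> \<noteq> 0 \<and> range (P {\<omega>}) = cspan {v \<omega>}"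
    by metis
  \<comment> \<open>Dividing by \<open>norm (v \<omega>)\<close> gives each term the norm
    \<open>(1/2) ^ n\<close>, with \<open>n\<close> the index of \<omega> in an enumeration of the
    atoms, so the series converges absolutely. The factor is nonzero, so each line is
    preserved.\<close>
  define c where "c \<omega> = complex_of_real ((1/2) ^ to_nat_on ?A \<omega> / norm (v \<omega>))" for \<omega>
  have range: "range (P {\<omega>}) = cspan {c \<omega> *\<^sub>C v \<omega>}" if "\<omega> \<in> ?A" for \<omega>
    using v[OF that] complex_vector.span_image_scale[of "{v \<omega>}" "\<lambda>_. c \<omega>"] by (simp add: c_def)
  have "(\<lambda>n. (1/2) ^ n :: real) summable_on UNIV"
    by (rule norm_summable_imp_summable_on) (simp add: norm_power summable_geometric)
  then have "(\<lambda>n. (1/2) ^ n :: real) summable_on to_nat_on ?A ` ?A"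
    by (rule summable_on_subset_banach) simp
  then have "((\<lambda>n. (1/2) ^ n :: real) \<circ> to_nat_on ?A) summable_on ?A"
    using assms(1) by (subst (asm) summable_on_reindex) (auto simp: inj_on_to_nat_on)
  then have "(\<lambda>\<omega>. norm (c \<omega> *\<^sub>C v \<omega>)) summable_on ?A"
    by (rule summable_on_cong[THEN iffD1, rotated])
      (use v in \<open>auto simp: c_def norm_scaleC norm_divide norm_power\<close>)
  then obtain \<phi> where \<phi>: "((\<lambda>\<omega>. c \<omega> *\<^sub>C v \<omega>) has_sum \<phi>) ?A"
    using abs_summable_summable summable_on_def by metis
  \<comment> \<open>Each term lies in the range of its own atom, so applying
    \<open>P {\<omega>}\<close> to the series keeps the term at \<omega> and kills all
    others.\<close>
  have "P {\<omega>} \<phi> = c \<omega> *\<^sub>C v \<omega>" if \<omega>: "\<omega> \<in> ?A" for \<omega>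
  proof -
    have mem: "{\<omega>'} \<in> sets (word_borel N)" if "\<omega>' \<in> ?A" for \<omega>'
      using that by (intro sets_word_singleton atoms_in_words)
    have "((\<lambda>\<omega>'. P {\<omega>} (c \<omega>' *\<^sub>C v \<omega>')) has_sum P {\<omega>} \<phi>) ?A"
      by (rule has_sum_bounded_linear[OF linear[OF mem[OF \<omega>]] \<phi>])
    moreover have "P {\<omega>} (c \<omega>' *\<^sub>C v \<omega>') = (if \<omega>' = \<omega> then c \<omega> *\<^sub>C v \<omega> else 0)" if "\<omega>' \<in> ?A" for \<omega>'
    proof -
      have "c \<omega>' *\<^sub>C v \<omega>' \<in> range (P {\<omega>'})"
        unfolding range[OF that] by (simp add: complex_vector.span_base)
      then obtain z where "c \<omega>' *\<^sub>C v \<omega>' = P {\<omega>'} z"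
        by blast
      then show ?thesis
        using P_singleton_mult[OF atoms_in_words[OF \<omega>] mem[OF that], of z] by auto
    qed
    ultimately have "((\<lambda>\<omega>'. if \<omega>' = \<omega> then c \<omega> *\<^sub>C v \<omega> else 0) has_sum P {\<omega>} \<phi>) ?A"
      by (simp cong: has_sum_cong)
    moreover have "((\<lambda>\<omega>'. if \<omega>' = \<omega> then c \<omega> *\<^sub>C v \<omega> else 0) has_sum c \<omega> *\<^sub>C v \<omega>) ?A"
      using \<omega> by (intro has_sum_finite_neutralI[where B = "{\<omega>}"]) auto
    ultimately show ?thesis
      by (rule has_sum_unique)
  qed
  then show ?thesis
    unfolding monic_rep_def using range by (intro exI[of _ \<phi>] closure_cspan_orbit_UNIV) simp
qed

end


section \<open>Monic systems\<close>

text \<open>Checking the total mass is enough: the sums of point masses over a set and over its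
  complement are bounded by the two measures and add up to the full mass, so neither can fall
  short.\<close>

lemma (in finite_measure) atomic_measureI:
  assumes "\<Omega> \<subseteq> space M" "\<And>\<omega>. \<omega> \<in> \<Omega> \<Longrightarrow> {\<omega>} \<in> sets M"
    and total: "((\<lambda>\<omega>. measure M {\<omega>}) has_sum measure M (space M)) \<Omega>"
  shows "atomic_measure M"
proof -
  have sum_le: "infsum (\<lambda>\<omega>. measure M {\<omega>}) (A \<inter> \<Omega>) \<le> measure M A"
    if "A \<in> sets M" for A
  proof (rule infsum_le_finite_sums)
    show "(\<lambda>\<omega>. measure M {\<omega>}) summable_on A \<inter> \<Omega>"
      using total by (auto intro: summable_on_subset_banach has_sum_imp_summable)
    fix F assume F: "finite F" "F \<subseteq> A \<inter> \<Omega>"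
    then have "(\<Sum>\<omega>\<in>F. measure M {\<omega>}) = measure M F"
      using assms(2) by (intro measure_eq_sum_singleton[symmetric]) auto
    also have "\<dots> \<le> measure M A"
      using F that by (intro finite_measure_mono) auto
    finally show "(\<Sum>\<omega>\<in>F. measure M {\<omega>}) \<le> measure M A" .
  qed
  have "((\<lambda>\<omega>. emeasure M {\<omega>}) has_sum emeasure M A) (A \<inter> \<Omega>)" if A: "A \<in> sets M" for A
  proof -
    have summable: "(\<lambda>\<omega>. measure M {\<omega>}) summable_on B \<inter> \<Omega>" for B
      using total by (auto intro: summable_on_subset_banach has_sum_imp_summable)
    have "infsum (\<lambda>\<omega>. measure M {\<omega>}) (A \<inter> \<Omega>) + infsum (\<lambda>\<omega>. measure M {\<omega>}) ((space M - A) \<inter> \<Omega>) =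
        infsum (\<lambda>\<omega>. measure M {\<omega>}) (A \<inter> \<Omega> \<union> (space M - A) \<inter> \<Omega>)"
      by (intro infsum_Un_disjoint[symmetric] summable) auto
    also have "A \<inter> \<Omega> \<union> (space M - A) \<inter> \<Omega> = \<Omega>"
      using assms(1) by auto
    also have "infsum (\<lambda>\<omega>. measure M {\<omega>}) \<Omega> = measure M A + measure M (space M - A)"
      using total A by (simp add: infsumI finite_measure_compl)
    finally have "infsum (\<lambda>\<omega>. measure M {\<omega>}) (A \<inter> \<Omega>) = measure M A"
      using sum_le[OF A] sum_le[of "space M - A"] A by auto
    then have "((\<lambda>\<omega>. measure M {\<omega>}) has_sum measure M A) (A \<inter> \<Omega>)"
      using summable by (simp add: has_sum_iff)
    \<comment> \<open>The real sum becomes an extended one by continuity of \<open>ennreal\<close>,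
      which commutes with finite sums of nonnegative terms.\<close>
    then have "((\<lambda>F. ennreal (\<Sum>\<omega>\<in>F. measure M {\<omega>})) \<longlongrightarrow> ennreal (measure M A))
        (finite_subsets_at_top (A \<inter> \<Omega>))"
      unfolding has_sum_def by (rule tendsto_ennrealI)
    moreover have "sum (\<lambda>\<omega>. ennreal (measure M {\<omega>})) = (\<lambda>F. ennreal (\<Sum>\<omega>\<in>F. measure M {\<omega>}))"
      by (rule ext) (simp add: sum_ennreal)
    ultimately show ?thesis
      unfolding has_sum_def emeasure_eq_measure by simp
  qed
  then show ?thesis
    unfolding atomic_measure_def using assms(1) by blast
qed

section \<open>The measure of an equivalent monic system\<close>

locale atomic_rep_system = atomic_rep N S P
  for N :: nat
    and S :: "nat \<Rightarrow> 'h::complex_hilbert \<Rightarrow> 'h"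
    and P :: "(nat \<Rightarrow> nat) set \<Rightarrow> 'h \<Rightarrow> 'h" +
  fixes \<mu> :: "(nat \<Rightarrow> nat) measure"
    and f :: "nat \<Rightarrow> (nat \<Rightarrow> nat) \<Rightarrow> complex"
    and U :: "'h \<Rightarrow> (nat \<Rightarrow> nat) \<Rightarrow> complex"
  assumes system: "monic_system N \<mu> f"
    and unitary: "unitary_onto_L2 \<mu> U"
    and intertwines: "\<And>i x. i < N \<Longrightarrow> AE \<omega> in \<mu>. U (S i x) \<omega> = system_op f i (U x) \<omega>"
begin

sublocale finite_measure \<mu>
  using system by (simp add: monic_system_def)

lemma sets_eq [measurable_cong]: "sets \<mu> = sets (word_borel N)"
  using system by (simp add: monic_system_def)

lemma space_eq: "space \<mu> = words N"
  using sets_eq_imp_space_eq[OF sets_eq] by simp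

lemma U_measurable [measurable]: "U x \<in> borel_measurable \<mu>"
  using unitary by (simp add: unitary_onto_L2_def square_integrable_def)

lemma f_measurable: "i < N \<Longrightarrow> f i \<in> borel_measurable \<mu>"
  using system by (simp add: monic_system_def square_integrable_def)

lemma U_add: "AE \<omega> in \<mu>. U (x + y) \<omega> = U x \<omega> + U y \<omega>"
  using unitary by (simp add: unitary_onto_L2_def)

lemma U_zero: "AE \<omega> in \<mu>. U 0 \<omega> = 0"
  using U_add[of 0 0] by simp

lemma U_sum:
  assumes "finite A"
  shows "AE \<omega> in \<mu>. U (\<Sum>a\<in>A. g a) \<omega> = (\<Sum>a\<in>A. U (g a) \<omega>)"
  using assms
proof (induction A rule: finite_induct)
  case empty
  then show ?case
    using U_zero by simp
next
  case (insert a A)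
  show ?case
    using insert(3) U_add[of "g a" "\<Sum>a\<in>A. g a"] by eventually_elim (use insert in simp)
qed

text \<open>The image of \<open>\<mu>\<close> under \<open>prepend i\<close> has a density that vanishes exactly where \<open>f i\<close> does.\<close>

lemma AE_of_AE_prepend:
  assumes "i < N" "{\<omega> \<in> words N. Q \<omega>} \<in> sets (word_borel N)" "AE \<omega> in \<mu>. Q (prepend i \<omega>)"
  shows "AE \<omega> in \<mu>. f i \<omega> \<noteq> 0 \<longrightarrow> Q \<omega>"
proof -
  have [measurable]: "prepend i \<in> measurable \<mu> (word_borel N)"
    using measurable_prepend[OF assms(1)] measurable_cong_sets[OF sets_eq refl] by blast
  have [measurable]: "f i \<in> borel_measurable \<mu>"
    by (rule f_measurable[OF assms(1)])
  have distr_eq: "distr \<mu> (word_borel N) (prepend i) = density \<mu> (\<lambda>\<omega>. ennreal ((norm (f i \<omega>))\<^sup>2))"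
    using system assms(1) by (simp add: monic_system_def)
  have "AE \<omega> in density \<mu> (\<lambda>\<omega>. ennreal ((norm (f i \<omega>))\<^sup>2)). Q \<omega>"
    unfolding distr_eq[symmetric] using assms(2,3) by (subst AE_distr_iff) auto
  then show ?thesis
    by (subst (asm) AE_density) auto
qed

text \<open>By intertwining, each further letter \<open>i\<close> multiplies by \<open>f i\<close>
  and composes with \<open>shift\<close>. \<open>AE_of_AE_prepend\<close> carries the null set of
  the induction hypothesis through the shift, wherever \<open>f i\<close> is nonzero.\<close>

lemma U_word_op_support:
  assumes "I \<in> finite_words N"
  shows "AE \<omega> in \<mu>. \<omega> \<notin> cylinder N I \<longrightarrow> U (word_op S I y) \<omega> = 0"
  using assms
proof (induction I)
  case Nil
  have "AE \<omega> in \<mu>. \<omega> \<in> words N"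
    using AE_space[of \<mu>] by (simp add: space_eq)
  then show ?case
    by eventually_elim simp
next
  case (Cons i I)
  then have i: "i < N" and I: "I \<in> finite_words N"
    by (auto simp: finite_words_def)
  let ?u = "U (word_op S I y)"
  have [measurable]: "?u \<in> borel_measurable (word_borel N)"
    using U_measurable measurable_cong_sets[OF sets_eq refl] by blast
  \<comment> \<open>The transported property has two halves: where \<open>f i\<close> is nonzero the
    first letter is \<open>i\<close>, and the remaining factor vanishes unless the shifted word lies
    in the cylinder of \<open>I\<close>.\<close>
  have "{\<omega> \<in> space (word_borel N). \<omega> 0 = i \<and> (shift \<omega> \<notin> cylinder N I \<longrightarrow> ?u (shift \<omega>) = 0)}
      \<in> sets (word_borel N)"
    by measurable
  \<comment> \<open>Since \<open>shift\<close> undoes \<open>prepend i\<close>, the pulled-back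
    property is the induction hypothesis.\<close>
  moreover have "AE \<omega> in \<mu>. prepend i \<omega> 0 = i \<and>
      (shift (prepend i \<omega>) \<notin> cylinder N I \<longrightarrow> ?u (shift (prepend i \<omega>)) = 0)"
    using Cons.IH[OF I] by (simp add: prepend_def shift_def)
  ultimately have "AE \<omega> in \<mu>. f i \<omega> \<noteq> 0 \<longrightarrow>
      \<omega> 0 = i \<and> (shift \<omega> \<notin> cylinder N I \<longrightarrow> ?u (shift \<omega>) = 0)"
    by (intro AE_of_AE_prepend i) simp_all
  moreover have "AE \<omega> in \<mu>. U (word_op S (i # I) y) \<omega> = f i \<omega> * ?u (shift \<omega>)"
    using intertwines[OF i, of "word_op S I y"] by (simp add: word_op_def system_op_def)
  ultimately show ?case
    using AE_space by eventually_elim (auto simp: mem_cylinder_Cons space_eq)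
qed

text \<open>Only supports matter: the function of a word is the sum of those of its one-letter
  extensions, which live on disjoint cylinders, so each extension is the restriction of the sum to
  its own cylinder.\<close>

lemma U_P_cylinder:
  assumes one: "AE \<omega> in \<mu>. U x \<omega> = 1" and "I \<in> finite_words N"
  shows "AE \<omega> in \<mu>. U (P (cylinder N I) x) \<omega> = indicator (cylinder N I) \<omega>"
  using assms(2)
proof (induction I rule: rev_induct)
  case Nil
  show ?case
    using one AE_space by eventually_elim (use space[of x] in \<open>simp add: space_eq\<close>)
next
  case (snoc j I)
  then have j: "j < N" and I: "I \<in> finite_words N"
    by (auto simp: finite_words_def)
  let ?u = "\<lambda>k. U (P (cylinder N (I @ [k])) x)"
  have "P (\<Union>k<N. cylinder N (I @ [k])) x = (\<Sum>k<N. P (cylinder N (I @ [k])) x)"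
    by (rule UN_finite) (auto simp: sets_cylinder disjoint_family_on_def cylinder_snoc)
  then have "AE \<omega> in \<mu>. U (P (cylinder N I) x) \<omega> = (\<Sum>k<N. ?u k \<omega>)"
    using U_sum[of "{..<N}"] by (simp flip: cylinder_eq_UN_snoc)
  moreover have "AE \<omega> in \<mu>. \<forall>k\<in>{..<N}. \<omega> \<notin> cylinder N (I @ [k]) \<longrightarrow> ?u k \<omega> = 0"
  proof (intro AE_finite_allI)
    fix k assume "k \<in> {..<N}"
    then have "I @ [k] \<in> finite_words N"
      using I by (simp add: finite_words_def)
    from U_word_op_support[OF this] P_cylinder[OF this]
    show "AE \<omega> in \<mu>. \<omega> \<notin> cylinder N (I @ [k]) \<longrightarrow> ?u k \<omega> = 0"
      by simp
  qed simp
  ultimately show ?case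
    using snoc.IH[OF I]
  proof eventually_elim
    case (elim \<omega>)
    show ?case
    proof (cases "\<omega> \<in> cylinder N (I @ [j])")
      case True
      then have "(\<Sum>k<N. ?u k \<omega>) = ?u j \<omega>"
        using j elim(2) by (subst sum.remove[of _ j]) (auto simp: cylinder_snoc intro!: sum.neutral)
      then show ?thesis
        using True elim by (simp add: cylinder_snoc)
    qed (use j elim(2) in auto)
  qed
qed

text \<open>Unitarity writes the squared norm as the integral of the squared modulus, and an
  indicator equals its own square.\<close>

lemma measure_cylinder:
  assumes "AE \<omega> in \<mu>. U x \<omega> = 1" "I \<in> finite_words N"
  shows "measure \<mu> (cylinder N I) = (norm (P (cylinder N I) x))\<^sup>2"
proof -
  let ?y = "P (cylinder N I) x"
  have "complex_of_real ((norm ?y)\<^sup>2) = (LINT \<omega>|\<mu>. U ?y \<omega> * cnj (U ?y \<omega>))"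
    unfolding cinner_self[symmetric] using unitary unfolding unitary_onto_L2_def by blast
  also have "\<dots> = (LINT \<omega>|\<mu>. complex_of_real ((norm (U ?y \<omega>))\<^sup>2))"
    by (simp only: complex_norm_square)
  also have "\<dots> = (LINT \<omega>|\<mu>. complex_of_real (indicator (cylinder N I) \<omega>))"
    using U_P_cylinder[OF assms]
    by (intro integral_cong_AE) (auto simp: indicator_def sets_cylinder sets_eq elim!: eventually_mono)
  also have "\<dots> = complex_of_real (measure \<mu> (cylinder N I))"
    using sets.Int_space_eq2[of "cylinder N I" \<mu>] by (simp add: sets_cylinder sets_eq)
  finally show ?thesis
    by (simp only: of_real_eq_iff)
qed

lemma atomic_measure: "atomic_measure \<mu>"
proof -
  \<comment> \<open>The constant 1 is square integrable because \<mu> is finite, and surjectivity of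
    \<open>U\<close> yields a vector representing it.\<close>
  have "(\<lambda>_. 1) \<in> square_integrable \<mu>"
    by (simp add: square_integrable_def)
  then obtain x where x: "AE \<omega> in \<mu>. U x \<omega> = 1"
    using unitary by (fastforce simp: unitary_onto_L2_def)
  \<comment> \<open>Both sides are limits along the prefix cylinders of \<omega>, where they
    agree.\<close>
  have "measure \<mu> {\<omega>} = (norm (P {\<omega>} x))\<^sup>2" if \<omega>: "\<omega> \<in> words N" for \<omega>
  proof -
    have "range (\<lambda>n. cylinder N (map \<omega> [0..<n])) \<subseteq> sets \<mu>"
      by (auto simp: sets_cylinder sets_eq)
    then have "(\<lambda>n. measure \<mu> (cylinder N (map \<omega> [0..<n]))) \<longlonglongrightarrow> measure \<mu> {\<omega>}"
      using finite_Lim_measure_decseq[OF _ decseq_cylinder_prefix, of N \<omega>] \<omega>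
      by (simp add: INT_cylinder_prefix)
    moreover have "(\<lambda>n. (norm (P (cylinder N (map \<omega> [0..<n])) x))\<^sup>2) \<longlonglongrightarrow> (norm (P {\<omega>} x))\<^sup>2"
      by (intro tendsto_intros P_prefix_LIMSEQ \<omega>)
    ultimately show ?thesis
      using measure_cylinder[OF x] prefix_in_finite_words[OF \<omega>] by (simp add: LIMSEQ_unique)
  qed
  then have "((\<lambda>\<omega>. measure \<mu> {\<omega>}) has_sum (norm x)\<^sup>2) (atoms N P)"
    using norm_square_sum_atoms[of x] atoms_in_words by (simp cong: has_sum_cong)
  \<comment> \<open>The whole space is the cylinder of the empty word.\<close>
  moreover have "measure \<mu> (space \<mu>) = (norm x)\<^sup>2"
    using measure_cylinder[OF x, of "[]"] space[of x] by (simp add: finite_words_def space_eq)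
  ultimately have "((\<lambda>\<omega>. measure \<mu> {\<omega>}) has_sum measure \<mu> (space \<mu>)) (atoms N P)"
    by (simp only:)
  then show ?thesis
    by (rule atomic_measureI[rotated -1])
      (auto simp: space_eq sets_eq atoms_in_words sets_word_singleton)
qed

end

lemma (in finite_measure) countable_measure_atoms: "countable (measure_atoms M)"
  by (rule countable_subset[OF _ countable_support])
    (auto simp: measure_atoms_def emeasure_eq_measure)

theorem theorem3p15:
  fixes N :: nat
    and S :: "nat \<Rightarrow> 'h::complex_hilbert \<Rightarrow> 'h"
    and P :: "(nat \<Rightarrow> nat) set \<Rightarrow> 'h \<Rightarrow> 'h"
  assumes "N \<ge> 2"
    and "separable_space (euclidean :: 'h topology)"
    and "cuntz_rep N S"
    and "associated_pvm N S P"
    and "atomic_pvm N P"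
  shows "(monic_rep N S \<longleftrightarrow> (\<forall>\<omega>\<in>atoms N P. cdim (range (P {\<omega>})) = 1)) \<and>
    (monic_rep N S \<longrightarrow>
      countable (atoms N P) \<and>
      (\<forall>\<mu> f. monic_system N \<mu> f \<and> equivalent_to_system N S \<mu> f \<longrightarrow>
        atomic_measure \<mu> \<and> countable (measure_atoms \<mu>)))"
proof -
  interpret atomic_rep N S P
    using assms by unfold_locales
  have countable: "countable (atoms N P)"
    by (rule countable_atoms) fact
  have "atomic_measure \<mu> \<and> countable (measure_atoms \<mu>)"
    if system: "monic_system N \<mu> f" and equiv: "equivalent_to_system N S \<mu> f" for \<mu> f
  proof -
    obtain U where "unitary_onto_L2 \<mu> U"
      "\<And>i x. i < N \<Longrightarrow> AE \<omega> in \<mu>. U (S i x) \<omega> = system_op f i (U x) \<omega>"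
      using equiv by (auto simp: equivalent_to_system_def)
    then interpret atomic_rep_system N S P \<mu> f U
      using system by unfold_locales
    show ?thesis
      using atomic_measure countable_measure_atoms by simp
  qed
  then show ?thesis
    using countable monic_of_cdim_atoms cdim_atom_of_monic by blast
qed

end
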